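(* Let $n\ge 3$, let $I\subset(0,\infty)$ be an open interval, and let $a,c:I\to\mathbb{R}$ be smooth functions with $a>0$, $c(r)\neq 0$ and $c(r)r^2\neq 1$ for all $r\in I$. Let $F(x,y)=u\,\phi(r,s)$, with $r=|x|$, $u=|y|$, $s=\langle x,y\rangle/|y|$, be the spherically symmetric Finsler metric satisfying the $T$-condition given by $$\phi(r,s)=a(r)\,s^{\frac{c(r)r^2-1}{c(r)r^2}}\,(r^2-s^2)^{\frac{1}{2c(r)r^2}},\qquad r\in I,\ 0<s<r.$$ Then $F$ is Berwaldian if and only if there is a constant $C\neq 1$ such that $c(r)=\dfrac{C}{r^2}$ for all $r\in I$.
   Context: $\langle\cdot,\cdot\rangle$ and $|\cdot|$ are the Euclidean inner product and norm on $\mathbb{R}^n$. The metric $F$ is defined on the open conic set of pairs $(x,y)\in\mathbb{R}^n\times(\mathbb{R}^n\setminus\{0\})$ with $|x|\in I$ and $0<s<r$; on it $g_{ij}=\frac12\frac{\partial^2F^2}{\partial y^i\partial y^j}$ is nondegenerate, with inverse $g^{ij}$. $T$-condition: let $\ell_i=\partial F/\partial y^i$, $C_{ijk}=\frac12\,\partial g_{ij}/\partial y^k$, $C^r_{ij}=g^{rk}C_{kij}$. The T-tensor is $$T_{hijk}=F\,C_{hij}|_k+C_{hij}\ell_k+C_{hik}\ell_j+C_{hjk}\ell_i+C_{ijk}\ell_h,$$ $$C_{hij}|_k=\frac{\partial C_{hij}}{\partial y^k}-C^r_{hk}C_{rij}-C^r_{ik}C_{hrj}-C^r_{jk}C_{hir},$$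 and $F$ satisfies the $T$-condition if $T_{hijk}=0$ identically. Berwaldian: the geodesic spray coefficients of $F$ are $G^i=\frac14 g^{ih}\left(y^k\frac{\partial^2F^2}{\partial x^k\partial y^h}-\frac{\partial F^2}{\partial x^h}\right)$. $F$ is Berwaldian if $G^i_{jkh}:=\frac{\partial^3G^i}{\partial y^j\partial y^k\partial y^h}=0$ identically on the domain of $F$. *)

theory Defs
  imports "HOL-Analysis.Analysis"
begin

text \<open>
  Metrics are functions \<open>F x y\<close> of a position \<open>x\<close> and a direction \<open>y\<close>; tensor components are
  indexed by the coordinate type \<open>'n\<close>. The set \<open>conic_domain I\<close> is open whenever \<open>I\<close> is, so
  derivatives at its points do not depend on the values of a function outside it.
\<close>

definition smooth_on :: "real set \<Rightarrow> (real \<Rightarrow> real) \<Rightarrow> bool" where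
  "smooth_on S f \<longleftrightarrow> (\<forall>k. (deriv ^^ k) f differentiable_on S)"
  \<comment> \<open>meant for open \<open>S\<close>\<close>

definition partial :: "'n::finite \<Rightarrow> (real^'n \<Rightarrow> real) \<Rightarrow> real^'n \<Rightarrow> real" where
  "partial i f y = deriv (\<lambda>t. f (y + t *\<^sub>R axis i 1)) 0"

type_synonym 'n metric_fun = "real^'n \<Rightarrow> real^'n \<Rightarrow> real"

definition fund_tensor :: "'n::finite metric_fun \<Rightarrow> real^'n \<Rightarrow> real^'n \<Rightarrow> real^'n^'n" where
  "fund_tensor F x y = (\<chi> i j. 1/2 * partial i (partial j (\<lambda>z. (F x z)\<^sup>2)) y)"

definition inv_fund_tensor :: "'n::finite metric_fun \<Rightarrow> real^'n \<Rightarrow> real^'n \<Rightarrow> real^'n^'n" where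
  "inv_fund_tensor F x y = matrix_inv (fund_tensor F x y)"

definition ell :: "'n::finite metric_fun \<Rightarrow> real^'n \<Rightarrow> real^'n \<Rightarrow> 'n \<Rightarrow> real" where
  "ell F x y i = partial i (F x) y"

definition cartan :: "'n::finite metric_fun \<Rightarrow> real^'n \<Rightarrow> real^'n \<Rightarrow> 'n \<Rightarrow> 'n \<Rightarrow> 'n \<Rightarrow> real" where
  "cartan F x y i j k = 1/2 * partial k (\<lambda>z. fund_tensor F x z $ i $ j) y"

text \<open>\<open>cartan_up F x y r i j\<close> is \<open>C\<^sup>r\<^sub>i\<^sub>j\<close>.\<close>

definition cartan_up :: "'n::finite metric_fun \<Rightarrow> real^'n \<Rightarrow> real^'n \<Rightarrow> 'n \<Rightarrow> 'n \<Rightarrow> 'n \<Rightarrow> real" where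
  "cartan_up F x y r i j = (\<Sum>k\<in>UNIV. inv_fund_tensor F x y $ r $ k * cartan F x y k i j)"

text \<open>\<open>cartan_vcov F x y h i j k\<close> is the vertical covariant derivative \<open>C\<^sub>h\<^sub>i\<^sub>j|\<^sub>k\<close>.\<close>

definition cartan_vcov ::
  "'n::finite metric_fun \<Rightarrow> real^'n \<Rightarrow> real^'n \<Rightarrow> 'n \<Rightarrow> 'n \<Rightarrow> 'n \<Rightarrow> 'n \<Rightarrow> real" where
  "cartan_vcov F x y h i j k =
     partial k (\<lambda>z. cartan F x z h i j) y
     - (\<Sum>r\<in>UNIV. cartan_up F x y r h k * cartan F x y r i j)
     - (\<Sum>r\<in>UNIV. cartan_up F x y r i k * cartan F x y h r j)
     - (\<Sum>r\<in>UNIV. cartan_up F x y r j k * cartan F x y h i r)"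

definition T_tensor ::
  "'n::finite metric_fun \<Rightarrow> real^'n \<Rightarrow> real^'n \<Rightarrow> 'n \<Rightarrow> 'n \<Rightarrow> 'n \<Rightarrow> 'n \<Rightarrow> real" where
  "T_tensor F x y h i j k =
     F x y * cartan_vcov F x y h i j k
     + cartan F x y h i j * ell F x y k
     + cartan F x y h i k * ell F x y j
     + cartan F x y h j k * ell F x y i
     + cartan F x y i j k * ell F x y h"

definition T_condition :: "((real^'n) \<times> (real^'n)) set \<Rightarrow> 'n::finite metric_fun \<Rightarrow> bool" where
  "T_condition D F \<longleftrightarrow> (\<forall>(x, y)\<in>D. \<forall>h i j k. T_tensor F x y h i j k = 0)"

definition spray :: "'n::finite metric_fun \<Rightarrow> real^'n \<Rightarrow> real^'n \<Rightarrow> 'n \<Rightarrow> real" where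
  "spray F x y i = 1/4 * (\<Sum>h\<in>UNIV. inv_fund_tensor F x y $ i $ h *
     ((\<Sum>k\<in>UNIV. y $ k * partial k (\<lambda>w. partial h (\<lambda>z. (F w z)\<^sup>2) y) x)
      - partial h (\<lambda>w. (F w y)\<^sup>2) x))"

definition berwaldian :: "((real^'n) \<times> (real^'n)) set \<Rightarrow> 'n::finite metric_fun \<Rightarrow> bool" where
  "berwaldian D F \<longleftrightarrow> (\<forall>(x, y)\<in>D. \<forall>i j k h.
     partial j (partial k (partial h (\<lambda>z. spray F x z i))) y = 0)"

definition spherical_metric :: "(real \<Rightarrow> real \<Rightarrow> real) \<Rightarrow> 'n::finite metric_fun" where
  "spherical_metric \<phi> x y = norm y * \<phi> (norm x) (x \<bullet> y / norm y)"

definition conic_domain :: "real set \<Rightarrow> ((real^'n::finite) \<times> (real^'n)) set" where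
  "conic_domain I = {(x, y). norm x \<in> I \<and> y \<noteq> 0 \<and> 0 < x \<bullet> y / norm y \<and> x \<bullet> y / norm y < norm x}"

end

theory Submission
  imports Defs
begin

text \<open>
  Put \<open>v = \<langle>x, y\<rangle>\<close>, \<open>w = |x|\<^sup>2 |y|\<^sup>2 - \<langle>x, y\<rangle>\<^sup>2\<close> and \<open>\<gamma>(r) = 1 / (c(r) r\<^sup>2)\<close>.  Then
  \<open>F\<^sup>2 = a(r)\<^sup>2 v\<^bsup>2 - 2\<gamma>\<^esup> w\<^bsup>\<gamma>\<^esup>\<close>.  Since \<open>w\<close> is constant when \<open>y\<close> moves along \<open>x\<close> and when \<open>x\<close> moves
  along \<open>y\<close>, the equation for the spray is easily solved: \<open>G = p y + q x\<close>, where \<open>p\<close> is linear in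
  \<open>y\<close> and \<open>q\<close> is a quadratic form in \<open>y\<close> plus a multiple of \<open>\<gamma>'(r) v\<^sup>2 ln (w / v\<^sup>2)\<close>.  The third
  derivative along \<open>x\<close> of the last term vanishes only if \<open>\<gamma>'(r) = 0\<close>, so \<open>F\<close> is Berwaldian exactly
  when \<open>\<gamma>\<close> is constant on the interval \<open>I\<close>.
\<close>

section \<open>Partial derivatives, their locality and iterated third order\<close>

lemma partial_eqI:
  assumes "(f has_derivative f') (at y)"
  shows "partial i f y = f' (axis i 1)"
proof -
  have "((\<lambda>t. y + t *\<^sub>R axis i 1) has_derivative (\<lambda>t. t *\<^sub>R axis i 1)) (at 0)"
    by (auto intro!: derivative_eq_intros)
  moreover have "(f has_derivative f') (at (y + 0 *\<^sub>R axis i 1))"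
    using assms by simp
  ultimately have "((\<lambda>t. f (y + t *\<^sub>R axis i 1)) has_derivative (\<lambda>t. f' (t *\<^sub>R axis i 1))) (at 0)"
    by (rule has_derivative_compose)
  moreover have "f' (t *\<^sub>R axis i 1) = f' (axis i 1) * t" for t
    using has_derivative_bounded_linear[OF assms]
    by (simp add: linear_simps)
  ultimately show ?thesis
    unfolding partial_def by (intro DERIV_imp_deriv) (simp add: has_field_derivative_def)
qed

text \<open>Only values near \<open>y\<close> enter a partial derivative. Since the closed formulas
  for \<open>F\<close> and its spray hold only on the open domain, every replacement under
  \<open>partial\<close> goes through this fact.\<close>

lemma partial_cong_open:
  assumes "open S" and "y \<in> S" and "\<And>z. z \<in> S \<Longrightarrow> f z = g z"
  shows "partial i f y = partial i g y"
proof -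
  have "((\<lambda>t. y + t *\<^sub>R axis i 1) \<longlongrightarrow> y + 0 *\<^sub>R axis i 1) (nhds (0::real))"
    by (intro tendsto_intros filterlim_ident)
  then have "\<forall>\<^sub>F t in nhds (0::real). y + t *\<^sub>R axis i 1 \<in> S"
    using assms(1,2) by (simp add: tendsto_def)
  then have "\<forall>\<^sub>F t in nhds 0. f (y + t *\<^sub>R axis i 1) = g (y + t *\<^sub>R axis i 1)"
    by eventually_elim (rule assms(3))
  then show ?thesis
    unfolding partial_def by (intro deriv_cong_ev) auto
qed

lemma partial_on_line:
  "partial i f (y + t *\<^sub>R axis i 1) = deriv (\<lambda>\<tau>. f (y + \<tau> *\<^sub>R axis i 1)) t"
proof -
  have "deriv (\<lambda>\<tau>. f (y + \<tau> *\<^sub>R axis i 1)) t = deriv ((\<lambda>\<tau>. f (y + \<tau> *\<^sub>R axis i 1)) \<circ> (+) t) 0"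
    by (rule deriv_shift_0)
  then show ?thesis
    by (simp add: partial_def o_def scaleR_add_left add.assoc)
qed

text \<open>Iterating one and the same partial derivative stays on a single line, so it becomes a
  one-variable problem.\<close>

lemma third_partial_eq_deriv:
  "partial i (partial i (partial i f)) y = (deriv ^^ 3) (\<lambda>t. f (y + t *\<^sub>R axis i 1)) 0"
  using partial_on_line[of i "partial i (partial i f)" y 0]
  by (simp add: partial_on_line eval_nat_numeral)

lemma vec_nth_has_derivative [derivative_intros]:
  "((\<lambda>z::real^'n::finite. z $ i) has_derivative (\<lambda>k. k $ i)) (at y)"
  by (rule bounded_linear_imp_has_derivative) (rule bounded_linear_vec_nth)

text \<open>This is the shape of a spray component when \<gamma> is locally constant: a quadratic
  form in \<open>y\<close>, whose second partials are constants.\<close>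

lemma third_partial_quadratic:
  fixes x :: "real^'n::finite"
  shows "partial j (partial k (partial h
    (\<lambda>y. \<alpha> * (x \<bullet> y) * y $ i + \<beta> * (x \<bullet> y)\<^sup>2 + \<delta> * (y \<bullet> y)))) y = 0"
proof -
  have "((\<lambda>y. \<alpha> * (x \<bullet> y) * y $ i + \<beta> * (x \<bullet> y)\<^sup>2 + \<delta> * (y \<bullet> y)) has_derivative
    (\<lambda>d. \<alpha> * ((x \<bullet> d) * y $ i + (x \<bullet> y) * d $ i) + 2 * \<beta> * (x \<bullet> d) * (x \<bullet> y) + 2 * \<delta> * (y \<bullet> d)))
    (at y)" for y
    by (auto intro!: derivative_eq_intros simp: inner_commute algebra_simps)
  from partial_eqI[OF this] have 1: "partial h (\<lambda>y. \<alpha> * (x \<bullet> y) * y $ i + \<beta> * (x \<bullet> y)\<^sup>2 + \<delta> * (y \<bullet> y)) =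
    (\<lambda>y. \<alpha> * (x $ h * y $ i + (x \<bullet> y) * axis h 1 $ i) + 2 * \<beta> * x $ h * (x \<bullet> y) + 2 * \<delta> * y $ h)"
    by (simp add: fun_eq_iff inner_axis)
  have "((\<lambda>y. \<alpha> * (x $ h * y $ i + (x \<bullet> y) * axis h 1 $ i)
      + 2 * \<beta> * x $ h * (x \<bullet> y) + 2 * \<delta> * y $ h) has_derivative
    (\<lambda>d. \<alpha> * (x $ h * d $ i + (x \<bullet> d) * axis h 1 $ i) + 2 * \<beta> * x $ h * (x \<bullet> d) + 2 * \<delta> * d $ h))
    (at y)" for y
    by (auto intro!: derivative_eq_intros simp: algebra_simps)
  from partial_eqI[OF this] have 2: "partial k (\<lambda>y. \<alpha> * (x $ h * y $ i + (x \<bullet> y) * axis h 1 $ i)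
      + 2 * \<beta> * x $ h * (x \<bullet> y) + 2 * \<delta> * y $ h) =
    (\<lambda>y. \<alpha> * (x $ h * axis k 1 $ i + x $ k * axis h 1 $ i) + 2 * \<beta> * x $ h * x $ k
      + 2 * \<delta> * axis k 1 $ h)"
    by (simp add: fun_eq_iff inner_axis)
  show ?thesis
    unfolding 1 2 by (simp add: partial_def)
qed

lemma third_partial_cong_open:
  assumes "open S" and "y \<in> S" and "\<And>z. z \<in> S \<Longrightarrow> f z = g z"
  shows "partial j (partial k (partial h f)) y = partial j (partial k (partial h g)) y"
  by (intro partial_cong_open[OF assms(1)] assms(2,3))

text \<open>The quadratic part dies, while \<open>(1 + t)\<^sup>2 * ln (1 + t)\<close> has third
  derivative \<open>2 / (1 + t)\<close>. This detects the logarithm in the spray.\<close>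

lemma third_deriv_square_ln:
  "(deriv ^^ 3) (\<lambda>t. \<alpha> * (1 + t)\<^sup>2 + \<beta> + \<gamma> * (1 + t)\<^sup>2 * ln (1 + t)) 0 = 2 * (\<gamma>::real)"
proof -
  \<comment> \<open>The derivative formulas hold only where \<open>1 + t\<close> is positive, so
    each simplified form may be differentiated again only as a local equality on that
    half-line.\<close>
  have cong: "deriv f t = deriv g t" if "\<And>s. s > -1 \<Longrightarrow> f s = g s" "t > -1" for f g :: "real \<Rightarrow> real" and t
  proof (rule deriv_cong_ev)
    show "\<forall>\<^sub>F x in nhds t. f x = g x"
      using eventually_nhds_in_open[of "{-1<..}" t] that by (auto elim: eventually_mono)
  qed simp
  have 1: "deriv (\<lambda>t. \<alpha> * (1 + t)\<^sup>2 + \<beta> + \<gamma> * (1 + t)\<^sup>2 * ln (1 + t)) t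
      = (2 * \<alpha> + \<gamma>) * (1 + t) + 2 * \<gamma> * (1 + t) * ln (1 + t)" if "t > -1" for t
    using that
    by (intro DERIV_imp_deriv) (auto intro!: derivative_eq_intros simp: divide_simps power2_eq_square; algebra)
  have 2: "deriv (\<lambda>t. (2 * \<alpha> + \<gamma>) * (1 + t) + 2 * \<gamma> * (1 + t) * ln (1 + t)) t
      = 2 * \<alpha> + 3 * \<gamma> + 2 * \<gamma> * ln (1 + t)" if "t > -1" for t
    using that by (intro DERIV_imp_deriv) (auto intro!: derivative_eq_intros simp: divide_simps; algebra)
  have 3: "deriv (\<lambda>t. 2 * \<alpha> + 3 * \<gamma> + 2 * \<gamma> * ln (1 + t)) 0 = 2 * \<gamma>"
    by (intro DERIV_imp_deriv) (auto intro!: derivative_eq_intros)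
  have "deriv (deriv (\<lambda>t. \<alpha> * (1 + t)\<^sup>2 + \<beta> + \<gamma> * (1 + t)\<^sup>2 * ln (1 + t))) t
      = 2 * \<alpha> + 3 * \<gamma> + 2 * \<gamma> * ln (1 + t)" if "t > -1" for t
    using cong[OF 1 that] 2[OF that] by simp
  then have "deriv (deriv (deriv (\<lambda>t. \<alpha> * (1 + t)\<^sup>2 + \<beta> + \<gamma> * (1 + t)\<^sup>2 * ln (1 + t)))) 0
      = deriv (\<lambda>t. 2 * \<alpha> + 3 * \<gamma> + 2 * \<gamma> * ln (1 + t)) 0"
    by (rule cong) auto
  with 3 show ?thesis
    by (simp add: numeral_3_eq_3)
qed

section \<open>Gram determinant and the conic domain\<close>

definition gram :: "'a::real_inner \<Rightarrow> 'a \<Rightarrow> real" where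
  "gram x y = (x \<bullet> x) * (y \<bullet> y) - (x \<bullet> y)\<^sup>2"

text \<open>Half the gradient of \<open>gram x\<close> at \<open>y\<close>. For nonzero
  \<open>x\<close> it is \<open>x \<bullet> x\<close> times the component of \<open>y\<close>
  orthogonal to \<open>x\<close>.\<close>

definition half_gram_grad :: "'a::real_inner \<Rightarrow> 'a \<Rightarrow> 'a" where
  "half_gram_grad x y = (x \<bullet> x) *\<^sub>R y - (x \<bullet> y) *\<^sub>R x"

text \<open>Multiplying \<open>s < r\<close> by \<open>norm y\<close> and squaring gives positivity
  of the Gram determinant. Positivity of \<open>x \<bullet> y\<close> already excludes
  \<open>y = 0\<close>.\<close>

lemma conic_domain_iff:
  "(x, y) \<in> conic_domain I \<longleftrightarrow> norm x \<in> I \<and> 0 < x \<bullet> y \<and> 0 < gram x y"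
proof (cases "y = 0")
  case False
  have "x \<bullet> y < norm x * norm y \<longleftrightarrow> (x \<bullet> y)\<^sup>2 < (norm x * norm y)\<^sup>2" if "0 < x \<bullet> y"
    using that abs_less_iff power2_less_imp_less[of "x \<bullet> y" "norm x * norm y"]
      power_strict_mono[of "x \<bullet> y" "norm x * norm y" 2] by auto
  with False show ?thesis
    by (auto simp: conic_domain_def gram_def power_mult_distrib power2_norm_eq_inner
        zero_less_divide_iff divide_less_eq)
qed (simp add: conic_domain_def)

lemma open_conic_domain:
  assumes "open I"
  shows "open (conic_domain I :: ((real^'n::finite) \<times> (real^'n)) set)"
proof -
  have "conic_domain I = {p :: (real^'n) \<times> (real^'n). norm (fst p) \<in> I}
     \<inter> {p. 0 < fst p \<bullet> snd p} \<inter> {p. 0 < gram (fst p) (snd p)}"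
    by (auto simp: conic_domain_iff)
  moreover have "open {p :: (real^'n) \<times> (real^'n). norm (fst p) \<in> I}"
  proof -
    have "continuous_on UNIV (\<lambda>p :: (real^'n) \<times> (real^'n). norm (fst p))"
      by (intro continuous_intros)
    from open_vimage[OF assms this] show ?thesis
      by (simp add: vimage_def)
  qed
  moreover have "open {p :: (real^'n) \<times> (real^'n). 0 < fst p \<bullet> snd p}"
    by (intro open_Collect_less continuous_intros)
  moreover have "open {p :: (real^'n) \<times> (real^'n). 0 < gram (fst p) (snd p)}"
    unfolding gram_def by (intro open_Collect_less continuous_intros)
  ultimately show ?thesis
    by auto
qed

lemma open_conic_slices:
  assumes "open I"
  shows "open {z. (x, z) \<in> conic_domain I}" and "open {w. (w, y) \<in> conic_domain I}"
  using open_vimage[OF open_conic_domain[OF assms], of "Pair x"]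
    open_vimage[OF open_conic_domain[OF assms], of "\<lambda>w. (w, y)"]
  by (simp_all add: vimage_def continuous_on_Pair continuous_on_const continuous_on_id)


lemma inner_half_gram_grad [simp]:
  "x \<bullet> half_gram_grad x y = 0" "half_gram_grad x y \<bullet> x = 0"
  "y \<bullet> half_gram_grad x y = gram x y" "half_gram_grad x y \<bullet> y = gram x y"
  by (simp_all add: half_gram_grad_def gram_def inner_diff_right inner_diff_left inner_commute
      power2_eq_square)

lemma gram_commute: "gram x y = gram y x"
  by (simp add: gram_def inner_commute)

lemma gram_has_derivative [derivative_intros]:
  "((\<lambda>z. gram x z) has_derivative (\<lambda>k. 2 * (half_gram_grad x y \<bullet> k))) (at y)"
  unfolding gram_def half_gram_grad_def
  by (auto intro!: derivative_eq_intros simp: inner_commute algebra_simps)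

lemma gram_has_derivative_left [derivative_intros]:
  "((\<lambda>w. gram w y) has_derivative (\<lambda>k. 2 * (half_gram_grad y x \<bullet> k))) (at x)"
  using gram_has_derivative[of y x] by (simp add: gram_commute[of _ y])

lemma norm_compose_has_derivative:
  fixes x :: "'a::real_inner"
  assumes "(f has_real_derivative f') (at (norm x))" and "x \<noteq> 0"
  shows "((\<lambda>w. f (norm w)) has_derivative (\<lambda>k. f' / norm x * (x \<bullet> k))) (at x)"
proof -
  have "(norm has_derivative (\<lambda>k. sgn x \<bullet> k)) (at x)"
    using has_derivative_norm[OF assms(2)] by (simp add: inner_commute)
  from has_derivative_compose[OF this assms(1)[unfolded has_field_derivative_def]]
  show ?thesis
    by (simp add: sgn_div_norm field_simps)
qed

text \<open>The gradient in \<open>y\<close> of the logarithm of the squared metric, with \<gamma>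
  standing for the exponent at radius \<open>norm x\<close>.\<close>

definition log_grad :: "real \<Rightarrow> 'a::real_inner \<Rightarrow> 'a \<Rightarrow> 'a" where
  "log_grad \<gamma> x y = ((2 - 2 * \<gamma>) / (x \<bullet> y)) *\<^sub>R x + (2 * \<gamma> / gram x y) *\<^sub>R half_gram_grad x y"

lemma log_grad_has_derivative:
  fixes x y :: "real^'n::finite"
  assumes "x \<bullet> y \<noteq> 0" and "gram x y \<noteq> 0"
  shows "((\<lambda>z. log_grad \<gamma> x z $ i) has_derivative (\<lambda>k.
      - ((2 - 2 * \<gamma>) / (x \<bullet> y)\<^sup>2 + 2 * \<gamma> / gram x y) * x $ i * (x \<bullet> k)
      - 4 * \<gamma> / (gram x y)\<^sup>2 * half_gram_grad x y $ i * (half_gram_grad x y \<bullet> k)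
      + 2 * \<gamma> * (x \<bullet> x) / gram x y * k $ i)) (at y)"
proof -
  have K: "((\<lambda>z. half_gram_grad x z $ i) has_derivative
      (\<lambda>k. (x \<bullet> x) * k $ i - (x \<bullet> k) * x $ i)) (at y)"
    unfolding half_gram_grad_def by (auto intro!: derivative_eq_intros)
  show ?thesis
    unfolding log_grad_def vector_add_component vector_scaleR_component
    by (rule has_derivative_eq_rhs, (rule derivative_intros K assms)+)
      (use assms in \<open>auto simp: fun_eq_iff field_simps power2_eq_square\<close>)
qed

lemma matrix_inv_left:
  assumes "invertible A"
  shows "matrix_inv A ** A = mat 1"
  using someI_ex[OF assms[unfolded invertible_def]] by (simp add: matrix_inv_def)

section \<open>The fundamental tensor and its invertibility\<close>

text \<open>Here \<open>A\<close> stands for \<open>2 * ln a\<close> and \<open>g\<close> for the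
  exponent \<gamma>. Writing the squared metric as an exponential of logarithms makes all its
  derivatives multiples of itself.\<close>

locale spherical_power =
  fixes I :: "real set" and A A' g g' :: "real \<Rightarrow> real"
    and F :: "real^'n::finite \<Rightarrow> real^'n \<Rightarrow> real"
  assumes open_I: "open I" and pos_I: "I \<subseteq> {0<..}"
    and A_deriv: "\<And>r. r \<in> I \<Longrightarrow> (A has_real_derivative A' r) (at r)"
    and g_deriv: "\<And>r. r \<in> I \<Longrightarrow> (g has_real_derivative g' r) (at r)"
    and g_neq: "\<And>r. r \<in> I \<Longrightarrow> g r \<noteq> 0" "\<And>r. r \<in> I \<Longrightarrow> g r \<noteq> 1"
    and F_square: "\<And>x y. (x, y) \<in> conic_domain I \<Longrightarrow> (F x y)\<^sup>2 =
      exp (A (norm x) + (2 - 2 * g (norm x)) * ln (x \<bullet> y) + g (norm x) * ln (gram x y))"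
begin

definition energy :: "real^'n \<Rightarrow> real^'n \<Rightarrow> real" where
  "energy x y =
    exp (A (norm x) + (2 - 2 * g (norm x)) * ln (x \<bullet> y) + g (norm x) * ln (gram x y))"

text \<open>The derivative in \<open>x\<close> of the logarithm of \<open>energy\<close>, taken
  through \<open>norm x\<close> alone, is this scalar times \<open>x\<close>. It is the source of
  the logarithm in the spray.\<close>

definition radial_log_deriv :: "real^'n \<Rightarrow> real^'n \<Rightarrow> real" where
  "radial_log_deriv x y =
    (A' (norm x) + g' (norm x) * (ln (gram x y) - 2 * ln (x \<bullet> y))) / norm x"

lemma domainD:
  assumes "(x, y) \<in> conic_domain I"
  shows "norm x \<in> I" "x \<bullet> y > 0" "gram x y > 0" "x \<noteq> 0" "norm x > 0"
  using assms pos_I by (auto simp: conic_domain_iff)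

lemma energy_has_derivative:
  assumes "(x, y) \<in> conic_domain I"
  shows "(energy x has_derivative (\<lambda>k. energy x y * (log_grad (g (norm x)) x y \<bullet> k))) (at y)"
  using domainD[OF assms] unfolding energy_def
  by (auto intro!: derivative_eq_intros simp: log_grad_def inner_add_left fun_eq_iff field_simps)

lemma partial_energy:
  assumes "(x, y) \<in> conic_domain I"
  shows "partial i (\<lambda>z. (F x z)\<^sup>2) y = energy x y * log_grad (g (norm x)) x y $ i"
proof -
  have "partial i (\<lambda>z. (F x z)\<^sup>2) y = partial i (energy x) y"
    by (rule partial_cong_open[OF open_conic_slices(1)[OF open_I]]) (use assms F_square in \<open>auto simp: energy_def\<close>)
  then show ?thesis
    by (simp add: partial_eqI[OF energy_has_derivative[OF assms]] inner_axis)
qed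

text \<open>The Hessian of \<open>exp f\<close> is \<open>exp f\<close> times the sum of the Hessian
  of \<open>f\<close> and the square of its gradient; the gradient here is
  \<open>log_grad\<close>.\<close>

lemma fund_tensor_nth:
  assumes "(x, y) \<in> conic_domain I"
  defines "\<gamma> \<equiv> g (norm x)"
  shows "fund_tensor F x y $ j $ i = energy x y / 2 *
    (log_grad \<gamma> x y $ i * log_grad \<gamma> x y $ j
     - ((2 - 2 * \<gamma>) / (x \<bullet> y)\<^sup>2 + 2 * \<gamma> / gram x y) * x $ i * x $ j
     - 4 * \<gamma> / (gram x y)\<^sup>2 * half_gram_grad x y $ i * half_gram_grad x y $ j
     + 2 * \<gamma> * (x \<bullet> x) / gram x y * axis j 1 $ i)"
proof -
  note D = domainD[OF assms(1)]
  have "fund_tensor F x y $ j $ i = 1/2 * partial j (partial i (\<lambda>z. (F x z)\<^sup>2)) y"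
    by (simp add: fund_tensor_def)
  also have "partial j (partial i (\<lambda>z. (F x z)\<^sup>2)) y
      = partial j (\<lambda>z. energy x z * log_grad \<gamma> x z $ i) y"
    by (rule partial_cong_open[OF open_conic_slices(1)[OF open_I]])
      (use assms partial_energy in auto)
  also have "\<dots> = energy x y *
    (log_grad \<gamma> x y $ i * log_grad \<gamma> x y $ j
     - ((2 - 2 * \<gamma>) / (x \<bullet> y)\<^sup>2 + 2 * \<gamma> / gram x y) * x $ i * x $ j
     - 4 * \<gamma> / (gram x y)\<^sup>2 * half_gram_grad x y $ i * half_gram_grad x y $ j
     + 2 * \<gamma> * (x \<bullet> x) / gram x y * axis j 1 $ i)"
    using D
    by (subst partial_eqI[OF has_derivative_mult[OF energy_has_derivative[OF assms(1)]
          log_grad_has_derivative]])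
      (auto simp: inner_axis \<gamma>_def algebra_simps)
  finally show ?thesis by simp
qed

text \<open>In coordinate-free form the tensor is a multiple of the identity plus rank-one terms
  along \<open>log_grad\<close>, \<open>x\<close> and \<open>half_gram_grad\<close>, so the linear
  algebra reduces to a few inner products.\<close>

lemma fund_tensor_mult:
  assumes "(x, y) \<in> conic_domain I"
  defines "\<gamma> \<equiv> g (norm x)"
  shows "fund_tensor F x y *v \<xi> = (energy x y / 2) *\<^sub>R
    ((log_grad \<gamma> x y \<bullet> \<xi>) *\<^sub>R log_grad \<gamma> x y
     - (((2 - 2 * \<gamma>) / (x \<bullet> y)\<^sup>2 + 2 * \<gamma> / gram x y) * (x \<bullet> \<xi>)) *\<^sub>R x
     - (4 * \<gamma> / (gram x y)\<^sup>2 * (half_gram_grad x y \<bullet> \<xi>)) *\<^sub>R half_gram_grad x y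
     + (2 * \<gamma> * (x \<bullet> x) / gram x y) *\<^sub>R \<xi>)"
proof -
  have row: "fund_tensor F x y $ j = (energy x y / 2) *\<^sub>R
    (log_grad \<gamma> x y $ j *\<^sub>R log_grad \<gamma> x y
     - (((2 - 2 * \<gamma>) / (x \<bullet> y)\<^sup>2 + 2 * \<gamma> / gram x y) * x $ j) *\<^sub>R x
     - (4 * \<gamma> / (gram x y)\<^sup>2 * half_gram_grad x y $ j) *\<^sub>R half_gram_grad x y
     + (2 * \<gamma> * (x \<bullet> x) / gram x y) *\<^sub>R axis j 1)" for j
    unfolding vec_eq_iff by (simp add: fund_tensor_nth[OF assms(1)] \<gamma>_def mult_ac)
  show ?thesis
    unfolding vec_eq_iff matrix_vector_mul_component row
    by (simp add: inner_add_left inner_diff_left inner_axis' mult_ac)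
qed

text \<open>The second equation is Euler's relation: the squared metric is homogeneous of degree 2
  in \<open>y\<close>.\<close>

lemma log_grad_inner:
  assumes "(x, y) \<in> conic_domain I"
  shows "log_grad \<gamma> x y \<bullet> x = (2 - 2 * \<gamma>) * (x \<bullet> x) / (x \<bullet> y)" "log_grad \<gamma> x y \<bullet> y = 2"
  using domainD[OF assms] by (simp_all add: log_grad_def inner_add_left field_simps)

text \<open>A kernel vector is orthogonal to \<open>y\<close> (Euler's relation turns the product with \<open>y\<close> into the
  derivative of \<open>F\<^sup>2\<close>) and to \<open>x\<close>, and on what remains the Hessian is a nonzero multiple of the
  identity.\<close>

lemma invertible_fund_tensor:
  assumes "(x, y) \<in> conic_domain I"
  shows "invertible (fund_tensor F x y)"
proof -
  note D = domainD[OF assms]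
  define \<gamma> where "\<gamma> = g (norm x)"
  have \<gamma>: "\<gamma> \<noteq> 0" "\<gamma> \<noteq> 1" using g_neq[OF D(1)] by (auto simp: \<gamma>_def)
  have "\<xi> = 0" if "fund_tensor F x y *v \<xi> = 0" for \<xi>
  proof -
    define M where "M = log_grad \<gamma> x y \<bullet> \<xi>"
    define X where "X = x \<bullet> \<xi>"
    define K where "K = half_gram_grad x y \<bullet> \<xi>"
    let ?V = "M *\<^sub>R log_grad \<gamma> x y
     - (((2 - 2 * \<gamma>) / (x \<bullet> y)\<^sup>2 + 2 * \<gamma> / gram x y) * X) *\<^sub>R x
     - (4 * \<gamma> / (gram x y)\<^sup>2 * K) *\<^sub>R half_gram_grad x y
     + (2 * \<gamma> * (x \<bullet> x) / gram x y) *\<^sub>R \<xi>"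
    have V: "?V = 0"
      using that unfolding fund_tensor_mult[OF assms] M_def K_def X_def \<gamma>_def by (simp add: energy_def)
    have M: "M = (2 - 2 * \<gamma>) / (x \<bullet> y) * X + 2 * \<gamma> / gram x y * K"
      by (simp add: M_def X_def K_def log_grad_def inner_add_left)
    have K: "K = (x \<bullet> x) * (y \<bullet> \<xi>) - (x \<bullet> y) * X"
      by (simp add: K_def X_def half_gram_grad_def inner_diff_left)
    have "x \<bullet> x \<noteq> 0" using D(4) by simp
    with K have Y: "y \<bullet> \<xi> = (K + (x \<bullet> y) * X) / (x \<bullet> x)"
      by (simp add: field_simps)
    have "?V \<bullet> y = M"
      using D(2-4) unfolding M
      by (simp add: inner_add_left inner_diff_left log_grad_inner[OF assms] X_def[symmetric]
          inner_commute[of \<xi>] Y field_simps power2_eq_square)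
    with V have M0: "M = 0" by simp
    have "?V \<bullet> x = - (2 - 2 * \<gamma>) * (x \<bullet> x) / (x \<bullet> y)\<^sup>2 * X"
      unfolding M0 using D(2,3)
      by (simp add: inner_add_left inner_diff_left X_def[symmetric] inner_commute[of \<xi>] field_simps)
    \<comment> \<open>Here \<gamma> \<noteq> 1 enters. Then \<open>M = 0\<close> and \<gamma>
      \<noteq> 0 force \<open>K = 0\<close>, and only the nonzero multiple of \<xi> survives in
      \<open>?V\<close>.\<close>
    with V have X0: "X = 0" using \<gamma> D by simp
    with M0 M have "K = 0" using \<gamma> D by simp
    with V M0 X0 show "\<xi> = 0" using \<gamma> D by simp
  qed
  then show ?thesis
    by (simp add: invertible_left_inverse matrix_left_invertible_ker)
qed

section \<open>Position derivatives and the spray coefficients\<close>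

lemma energy_has_derivative_left:
  assumes "(x, y) \<in> conic_domain I"
  shows "((\<lambda>w. energy w y) has_derivative (\<lambda>k. energy x y *
    (radial_log_deriv x y * (x \<bullet> k) + (2 - 2 * g (norm x)) / (x \<bullet> y) * (y \<bullet> k)
     + 2 * g (norm x) / gram x y * (half_gram_grad y x \<bullet> k)))) (at x)"
proof -
  note D = domainD[OF assms]
  note d = norm_compose_has_derivative[OF A_deriv[OF D(1)] D(4)]
    norm_compose_has_derivative[OF g_deriv[OF D(1)] D(4)]
  show ?thesis
    unfolding energy_def radial_log_deriv_def
    by (rule has_derivative_eq_rhs, (rule derivative_intros d D(2,3))+)
      (use D in \<open>auto simp: fun_eq_iff field_simps inner_commute\<close>)
qed

lemma log_grad_has_derivative_left:
  assumes "(x, y) \<in> conic_domain I"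
  shows "((\<lambda>w. log_grad (g (norm w)) w y $ i) has_derivative (\<lambda>k.
      - 2 * (g' (norm x) / norm x * (x \<bullet> k)) * x $ i / (x \<bullet> y)
      + (2 - 2 * g (norm x)) * (k $ i / (x \<bullet> y) - x $ i * (y \<bullet> k) / (x \<bullet> y)\<^sup>2)
      + 2 * (g' (norm x) / norm x * (x \<bullet> k)) * half_gram_grad x y $ i / gram x y
      + 2 * g (norm x) * ((2 * (x \<bullet> k) * y $ i - (y \<bullet> k) * x $ i - (x \<bullet> y) * k $ i) / gram x y
        - half_gram_grad x y $ i * (2 * (half_gram_grad y x \<bullet> k)) / (gram x y)\<^sup>2))) (at x)"
proof -
  note D = domainD[OF assms]
  note d = norm_compose_has_derivative[OF g_deriv[OF D(1)] D(4)]
  have K: "((\<lambda>w. half_gram_grad w y $ i) has_derivative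
      (\<lambda>k. 2 * (x \<bullet> k) * y $ i - (y \<bullet> k) * x $ i - (x \<bullet> y) * k $ i)) (at x)"
    unfolding half_gram_grad_def
    by (auto intro!: derivative_eq_intros simp: inner_commute algebra_simps)
  have ne: "x \<bullet> y \<noteq> 0" "gram x y \<noteq> 0" using D by auto
  show ?thesis
    unfolding log_grad_def vector_add_component vector_scaleR_component
    by (rule has_derivative_eq_rhs, (rule derivative_intros d K ne)+)
      (use D in \<open>auto simp: fun_eq_iff field_simps inner_commute power2_eq_square\<close>)
qed


text \<open>The two coefficients solve \<open>g G = R / 4\<close> under the ansatz \<open>G = p y + q x\<close>, where \<open>R\<close> is the
  bracket in the definition of the spray; both sides are compared in the basis formed by \<open>x\<close> and
  \<^term>\<open>half_gram_grad x y\<close>.\<close>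

definition spray_y :: "real^'n \<Rightarrow> real^'n \<Rightarrow> real" where
  "spray_y x y = - (x \<bullet> y) * (g' (norm x) / norm x / (2 * g (norm x)) + 1 / (x \<bullet> x))"

definition spray_x :: "real^'n \<Rightarrow> real^'n \<Rightarrow> real" where
  "spray_x x y = (x \<bullet> y)\<^sup>2 / ((2 - 2 * g (norm x)) * (x \<bullet> x)) *
     (g' (norm x) / norm x / g (norm x) + 2 / (x \<bullet> x) + radial_log_deriv x y / 2)
     + (y \<bullet> y) / (2 * (x \<bullet> x))"

lemma spray_bracket_eq:
  assumes "(x, y) \<in> conic_domain I"
  shows "(\<Sum>k\<in>UNIV. y $ k * partial k (\<lambda>w. partial h (\<lambda>z. (F w z)\<^sup>2) y) x)
      - partial h (\<lambda>w. (F w y)\<^sup>2) x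
    = 4 * (fund_tensor F x y *v (spray_y x y *\<^sub>R y + spray_x x y *\<^sub>R x)) $ h"
proof -
  note D = domainD[OF assms]
  define \<gamma> where "\<gamma> = g (norm x)"
  define \<gamma>' where "\<gamma>' = g' (norm x) / norm x"
  define \<beta> where "\<beta> = radial_log_deriv x y"
  define L where "L = energy x y"
  define v where "v = x \<bullet> y"
  define w where "w = gram x y"
  define t where "t = x \<bullet> x"
  define z where "z = y \<bullet> y"
  define X where "X = x $ h"
  define K where "K = half_gram_grad x y $ h"
  define p where "p = spray_y x y"
  define q where "q = spray_x x y"
  have pos: "v > 0" "w > 0" "t > 0" using D by (simp_all add: v_def w_def t_def)
  have \<gamma>: "\<gamma> \<noteq> 0" "2 - 2 * \<gamma> \<noteq> 0" using g_neq[OF D(1)] by (auto simp: \<gamma>_def)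
  have w: "w = t * z - v\<^sup>2" by (simp add: w_def t_def z_def v_def gram_def)
  \<comment> \<open>From here on every vector is expanded in \<open>x\<close> and
    \<open>half_gram_grad x y\<close>, whose components are \<open>X\<close> and \<open>K\<close>.
    The claim becomes an identity between rational expressions in scalars.\<close>
  have Y: "y $ h = (K + v * X) / t"
    using pos by (simp add: K_def X_def half_gram_grad_def v_def t_def)
  have M: "log_grad \<gamma> x y $ h = (2 - 2 * \<gamma>) / v * X + 2 * \<gamma> / w * K"
    by (simp add: log_grad_def v_def w_def X_def K_def)
  have Z: "half_gram_grad y x $ h = (w * X - v * K) / t"
  proof -
    have "half_gram_grad y x $ h = z * X - v * y $ h"
      by (simp add: half_gram_grad_def z_def v_def X_def inner_commute)
    then show ?thesis unfolding Y using pos by (simp add: w field_simps power2_eq_square)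
  qed

  \<comment> \<open>The position derivative of \<open>energy * log_grad\<close> by the product rule.
    By linearity, the sum over \<open>k\<close> weighted by \<open>y $ k\<close> is its value in the
    direction \<open>y\<close>.\<close>
  define f' where "f' k =
      energy x y * (- 2 * (g' (norm x) / norm x * (x \<bullet> k)) * x $ h / (x \<bullet> y)
      + (2 - 2 * g (norm x)) * (k $ h / (x \<bullet> y) - x $ h * (y \<bullet> k) / (x \<bullet> y)\<^sup>2)
      + 2 * (g' (norm x) / norm x * (x \<bullet> k)) * half_gram_grad x y $ h / gram x y
      + 2 * g (norm x) * ((2 * (x \<bullet> k) * y $ h - (y \<bullet> k) * x $ h - (x \<bullet> y) * k $ h) / gram x y
        - half_gram_grad x y $ h * (2 * (half_gram_grad y x \<bullet> k)) / (gram x y)\<^sup>2))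
      + energy x y *
    (radial_log_deriv x y * (x \<bullet> k) + (2 - 2 * g (norm x)) / (x \<bullet> y) * (y \<bullet> k)
     + 2 * g (norm x) / gram x y * (half_gram_grad y x \<bullet> k)) * log_grad (g (norm x)) x y $ h"
    for k :: "real^'n"
  have f': "((\<lambda>w. energy w y * log_grad (g (norm w)) w y $ h) has_derivative f') (at x)"
    unfolding f'_def
    by (rule has_derivative_mult[OF energy_has_derivative_left[OF assms]
          log_grad_has_derivative_left[OF assms]])
  have "partial k (\<lambda>w. partial h (\<lambda>z. (F w z)\<^sup>2) y) x = f' (axis k 1)" for k
  proof -
    have "partial k (\<lambda>w. partial h (\<lambda>z. (F w z)\<^sup>2) y) x
        = partial k (\<lambda>w. energy w y * log_grad (g (norm w)) w y $ h) x"
      by (rule partial_cong_open[OF open_conic_slices(2)[OF open_I]])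
        (use assms partial_energy in auto)
    with partial_eqI[OF f'] show ?thesis by simp
  qed
  then have "(\<Sum>k\<in>UNIV. y $ k * partial k (\<lambda>w. partial h (\<lambda>z. (F w z)\<^sup>2) y) x)
      = f' (\<Sum>k\<in>UNIV. y $ k *\<^sub>R axis k 1)"
    using has_derivative_bounded_linear[OF f']
    by (simp add: linear_simps linear_sum bounded_linear.linear)
  also have "(\<Sum>k\<in>UNIV. y $ k *\<^sub>R axis k 1) = y"
    using basis_expansion[of y] by (simp add: scalar_mult_eq_scaleR)
  \<comment> \<open>In the direction \<open>y\<close> the derivative of the Gram determinant drops
    out, because \<open>half_gram_grad y x\<close> is orthogonal to \<open>y\<close>.\<close>
  also have "f' y = L * ((\<beta> * v + (2 - 2 * \<gamma>) * z / v) * log_grad \<gamma> x y $ h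
      - 2 * \<gamma>' * X + (2 - 2 * \<gamma>) * (y $ h / v - z * X / v\<^sup>2) + 2 * \<gamma>' * v * K / w
      + 2 * \<gamma> * (v * y $ h - z * X) / w)"
    using pos unfolding f'_def
    by (simp flip: \<gamma>_def \<gamma>'_def \<beta>_def L_def v_def w_def t_def z_def X_def K_def)
      (simp add: algebra_simps)
  also have "v * y $ h - z * X = - half_gram_grad y x $ h"
    by (simp add: half_gram_grad_def v_def z_def X_def inner_commute)
  finally have S1: "(\<Sum>k\<in>UNIV. y $ k * partial k (\<lambda>w. partial h (\<lambda>z. (F w z)\<^sup>2) y) x) =
      L * ((\<beta> * v + (2 - 2 * \<gamma>) * z / v) * log_grad \<gamma> x y $ h
      - 2 * \<gamma>' * X + (2 - 2 * \<gamma>) * (y $ h / v - z * X / v\<^sup>2) + 2 * \<gamma>' * v * K / w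
      + 2 * \<gamma> * (- half_gram_grad y x $ h) / w)" .

  have "partial h (\<lambda>w. (F w y)\<^sup>2) x = partial h (\<lambda>w. energy w y) x"
    by (rule partial_cong_open[OF open_conic_slices(2)[OF open_I]]) (use assms F_square in \<open>auto simp: energy_def\<close>)
  also have "\<dots> = L * (\<beta> * X + (2 - 2 * \<gamma>) / v * y $ h + 2 * \<gamma> / w * half_gram_grad y x $ h)"
    by (subst partial_eqI[OF energy_has_derivative_left[OF assms]])
      (simp add: inner_axis \<gamma>_def \<beta>_def L_def v_def w_def X_def)
  finally have S2: "partial h (\<lambda>w. (F w y)\<^sup>2) x
    = L * (\<beta> * X + (2 - 2 * \<gamma>) / v * y $ h + 2 * \<gamma> / w * half_gram_grad y x $ h)" .

  have p: "p = - v * (\<gamma>' / (2 * \<gamma>) + 1 / t)"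
    by (simp add: p_def spray_y_def v_def \<gamma>_def \<gamma>'_def t_def)
  have q: "q = v\<^sup>2 / ((2 - 2 * \<gamma>) * t) * (\<gamma>' / \<gamma> + 2 / t + \<beta> / 2) + z / (2 * t)"
    by (simp add: q_def spray_x_def v_def \<gamma>_def \<gamma>'_def t_def z_def \<beta>_def)

  \<comment> \<open>The ansatz leaves two linear equations for \<open>p\<close> and
    \<open>q\<close>. This one matches the coefficients of \<open>K\<close>, and \<open>pq'\<close>
    those of \<open>X\<close>.\<close>
  have pq: "p + (2 - 2 * \<gamma>) * q * t / v
      = ((\<beta> * v + (2 - 2 * \<gamma>) * z / v) + \<gamma>' * v / \<gamma> + 2 * v / t) / 2"
    unfolding p q using pos \<gamma> by (simp add: divide_simps power2_eq_square) algebra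
  have pq': "(2 - 2 * \<gamma>) * (p / v + (1 - 2 * \<gamma>) * q * t / v\<^sup>2)
      = ((\<beta> * v + (2 - 2 * \<gamma>) * z / v) * (2 - 2 * \<gamma>) / v - 2 * \<gamma>' - (2 - 2 * \<gamma>) * z / v\<^sup>2
         - 4 * \<gamma> / t - \<beta>) / 2"
    unfolding p q using pos \<gamma> by (simp add: divide_simps power2_eq_square) algebra

  have "(fund_tensor F x y *v (p *\<^sub>R y + q *\<^sub>R x)) $ h = L / 2 *
     ((2 * p + (2 - 2 * \<gamma>) * q * t / v) * ((2 - 2 * \<gamma>) / v * X + 2 * \<gamma> / w * K)
      - ((2 - 2 * \<gamma>) / v\<^sup>2 + 2 * \<gamma> / w) * (p * v + q * t) * X
      - 4 * \<gamma> / w\<^sup>2 * (p * w) * K + 2 * \<gamma> * t / w * (p * ((K + v * X) / t) + q * X))"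
    unfolding fund_tensor_mult[OF assms]
    by (simp add: inner_add_right log_grad_inner[OF assms] M Y
       flip: \<gamma>_def L_def v_def w_def t_def z_def X_def K_def)
  also have "\<dots> = L / 2 * ((2 - 2 * \<gamma>) * (p / v + (1 - 2 * \<gamma>) * q * t / v\<^sup>2) * X
      + 2 * \<gamma> / w * (p + (2 - 2 * \<gamma>) * q * t / v) * K)"
    using pos by (simp add: divide_simps power2_eq_square) algebra
  finally have S3: "4 * (fund_tensor F x y *v (p *\<^sub>R y + q *\<^sub>R x)) $ h = 2 * L *
     ((2 - 2 * \<gamma>) * (p / v + (1 - 2 * \<gamma>) * q * t / v\<^sup>2) * X
      + 2 * \<gamma> / w * (p + (2 - 2 * \<gamma>) * q * t / v) * K)"
    by simp
  show ?thesis
    unfolding S1 S2 p_def[symmetric] q_def[symmetric] S3 pq pq' M Z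
    using pos \<gamma> by (simp add: divide_simps power2_eq_square) algebra
qed

text \<open>The bracket is four times the fundamental tensor applied to the ansatz; invertibility
  removes the tensor and the factor 1/4 cancels.\<close>

lemma spray_eq:
  assumes "(x, y) \<in> conic_domain I"
  shows "spray F x y i = spray_y x y * y $ i + spray_x x y * x $ i"
proof -
  let ?G = "spray_y x y *\<^sub>R y + spray_x x y *\<^sub>R x"
  have "spray F x y i = (inv_fund_tensor F x y *v (fund_tensor F x y *v ?G)) $ i"
    unfolding spray_def spray_bracket_eq[OF assms]
    by (simp add: matrix_vector_mult_def[of "inv_fund_tensor F x y"] sum_distrib_left)
  also have "\<dots> = ?G $ i"
    by (simp add: matrix_vector_mul_assoc inv_fund_tensor_def
        matrix_inv_left[OF invertible_fund_tensor[OF assms]])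
  finally show ?thesis by simp
qed


section \<open>The Berwald condition as constancy of the exponent\<close>

lemma berwaldian_imp_deriv_zero:
  assumes B: "berwaldian (conic_domain I) F" and "r \<in> I" and "CARD('n) \<ge> 2"
  shows "g' r = 0"
proof -
  \<comment> \<open>A second coordinate direction is needed to keep \<open>y\<close> from being
    parallel to \<open>x\<close>, where the Gram determinant would vanish.\<close>
  obtain i j :: 'n where "i \<noteq> j"
  proof -
    have "\<not> CARD('n) \<le> Suc 0" using assms(3) by simp
    then show thesis using that by (auto simp: card_le_Suc0_iff_eq)
  qed
  have r: "r > 0" using assms(2) pos_I by auto
  have g: "g r \<noteq> 0" "2 - 2 * g r \<noteq> 0" using g_neq[OF assms(2)] by auto
  \<comment> \<open>Along this line \<open>w\<close> stays equal to \<open>r\<^sup>2\<close>, so only \<open>(1 + t)\<^sup>2 ln (1 + t)\<close> is not quadratic.\<close>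
  define x :: "real^'n" where "x = r *\<^sub>R axis i 1"
  define Y :: "real \<Rightarrow> real^'n" where "Y = (\<lambda>t. axis i 1 + axis j 1 + t *\<^sub>R axis i 1)"
  have x: "norm x = r" "x \<bullet> x = r\<^sup>2" "x $ i = r"
    using r by (simp_all add: x_def power2_eq_square inner_axis_axis)
  have j: "axis j (1::real) $ i = 0" "axis i (1::real) $ j = 0"
    using \<open>i \<noteq> j\<close> by (simp_all add: axis_def)
  have Y: "x \<bullet> Y t = r * (1 + t)" "Y t \<bullet> Y t = (1 + t)\<^sup>2 + 1" "Y t $ i = 1 + t" for t
    by (simp_all add: x_def Y_def inner_add_left inner_add_right inner_axis j
        power2_eq_square algebra_simps)
  have gram: "gram x (Y t) = r\<^sup>2" for t
    by (simp add: gram_def x Y power_mult_distrib) (simp add: algebra_simps)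
  have dom: "(x, Y t) \<in> conic_domain I" if "t > -1" for t
    using that r assms(2) by (simp add: conic_domain_iff x Y gram)
  \<comment> \<open>The coefficient of \<open>(1 + t)\<^sup>2\<close> collected from
    \<open>spray_y * y $ i\<close> and \<open>spray_x * x $ i\<close>. The separate constant
    \<open>1 / (2 * r)\<close> in \<open>f\<close> comes from the summand 1 in
    \<open>Y t \<bullet> Y t\<close>.\<close>
  define \<alpha> where "\<alpha> = - r * (g' r / r / (2 * g r) + 1 / r\<^sup>2)
      + r / (2 - 2 * g r) * (g' r / r / g r + 2 / r\<^sup>2 + A' r / (2 * r)) + 1 / (2 * r)"
  define f where "f = (\<lambda>t. \<alpha> * (1 + t)\<^sup>2 + 1 / (2 * r) + (- g' r / (2 - 2 * g r)) * (1 + t)\<^sup>2 * ln (1 + t))"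
  have S: "spray F x (Y t) i = f t" if t: "t > -1" for t
  proof -
    have ln: "ln (r\<^sup>2) - 2 * ln (r * (1 + t)) = - 2 * ln (1 + t)"
      using r t by (simp add: ln_mult ln_realpow)
    have 1: "spray_y x (Y t) * (1 + t) = (- r * (g' r / r / (2 * g r) + 1 / r\<^sup>2)) * (1 + t)\<^sup>2"
      by (simp add: spray_y_def x Y power2_eq_square)
    have "spray_x x (Y t) = (r * (1 + t))\<^sup>2 / ((2 - 2 * g r) * r\<^sup>2) *
       (g' r / r / g r + 2 / r\<^sup>2 + (A' r + g' r * (- 2 * ln (1 + t))) / r / 2)
       + ((1 + t)\<^sup>2 + 1) / (2 * r\<^sup>2)"
      unfolding spray_x_def radial_log_deriv_def x Y gram ln ..
    then have 2: "spray_x x (Y t) * r =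
        (r / (2 - 2 * g r) * (g' r / r / g r + 2 / r\<^sup>2 + A' r / (2 * r)) + 1 / (2 * r)) * (1 + t)\<^sup>2
        + 1 / (2 * r) + (- g' r / (2 - 2 * g r)) * (1 + t)\<^sup>2 * ln (1 + t)"
      using r g by (simp add: power_mult_distrib divide_simps power2_eq_square) algebra
    show ?thesis
      unfolding spray_eq[OF dom[OF t]] x Y 1 2 f_def \<alpha>_def by (simp add: algebra_simps)
  qed
  have "\<forall>\<^sub>F t in nhds 0. spray F x (Y t) i = f t"
    using eventually_nhds_in_open[of "{-1<..}" "0::real"] S by (auto elim: eventually_mono)
  then have "(deriv ^^ 3) (\<lambda>t. spray F x (Y t) i) 0 = (deriv ^^ 3) f 0"
    by (intro higher_deriv_cong_ev) auto
  moreover have "(x, axis i 1 + axis j 1) \<in> conic_domain I"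
    using dom[of 0] by (simp add: Y_def)
  then have "(deriv ^^ 3) (\<lambda>t. spray F x (Y t) i) 0 = 0"
    using B unfolding Y_def berwaldian_def
    by (auto simp flip: third_partial_eq_deriv[of _ "\<lambda>z. spray F x z i"])
  \<comment> \<open>The third derivative of \<open>f\<close> at 0 is
    \<open>- 2 * g' r / (2 - 2 * g r)\<close>, with nonzero denominator.\<close>
  ultimately show ?thesis
    using g unfolding f_def third_deriv_square_ln by simp
qed

text \<open>Without \<open>g'\<close> the logarithm disappears and \<open>radial_log_deriv\<close>
  no longer depends on \<open>y\<close>, so each spray component is a quadratic form in
  \<open>y\<close>.\<close>

lemma deriv_zero_imp_berwaldian:
  assumes "\<And>r. r \<in> I \<Longrightarrow> g' r = 0"
  shows "berwaldian (conic_domain I) F"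
  unfolding berwaldian_def
proof safe
  fix x y :: "real^'n" and i j k h :: 'n
  assume dom: "(x, y) \<in> conic_domain I"
  define e where "e = 2 - 2 * g (norm x)"
  let ?\<beta> = "x $ i / (e * (x \<bullet> x)) * (2 / (x \<bullet> x) + A' (norm x) / norm x / 2)"
  have "spray F x z i = (- 1 / (x \<bullet> x)) * (x \<bullet> z) * z $ i + ?\<beta> * (x \<bullet> z)\<^sup>2 + x $ i / (2 * (x \<bullet> x)) * (z \<bullet> z)"
    if "(x, z) \<in> conic_domain I" for z
    unfolding spray_eq[OF that] spray_y_def spray_x_def radial_log_deriv_def
      assms[OF domainD(1)[OF that]] e_def[symmetric]
    by (simp add: algebra_simps)
  then have "partial j (partial k (partial h (\<lambda>z. spray F x z i))) y = partial j (partial k (partial h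
    (\<lambda>z. (- 1 / (x \<bullet> x)) * (x \<bullet> z) * z $ i + ?\<beta> * (x \<bullet> z)\<^sup>2 + x $ i / (2 * (x \<bullet> x)) * (z \<bullet> z)))) y"
    by (intro third_partial_cong_open[OF open_conic_slices(1)[OF open_I]]) (use dom in auto)
  then show "partial j (partial k (partial h (\<lambda>z. spray F x z i))) y = 0"
    unfolding third_partial_quadratic .
qed

end

section \<open>The given metric and the constancy of \<open>c(r) r\<^sup>2\<close>\<close>

text \<open>\<kappa> stands for \<open>c(r) r\<^sup>2\<close>. The powers of \<open>norm y\<close>
  cancel, as their total exponent is
  \<open>1 - (\<kappa> - 1) / \<kappa> - 1 / \<kappa> = 0\<close>.\<close>

lemma spherical_metric_square:
  assumes "(x, y) \<in> conic_domain I" and "a > 0" and "\<kappa> \<noteq> 0"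
    and "\<phi> (norm x) (x \<bullet> y / norm y) = a * (x \<bullet> y / norm y) powr ((\<kappa> - 1) / \<kappa>) *
      ((norm x)\<^sup>2 - (x \<bullet> y / norm y)\<^sup>2) powr (1 / (2 * \<kappa>))"
  shows "(spherical_metric \<phi> x y)\<^sup>2 =
    exp (2 * ln a + (2 - 2 * (1 / \<kappa>)) * ln (x \<bullet> y) + 1 / \<kappa> * ln (gram x y))"
proof -
  have pos: "x \<bullet> y > 0" "gram x y > 0" "norm y > 0"
    using assms(1) by (auto simp: conic_domain_iff)
  have "(norm x)\<^sup>2 - (x \<bullet> y / norm y)\<^sup>2 = gram x y / (norm y)\<^sup>2"
    using pos by (simp add: gram_def power2_norm_eq_inner power_divide divide_simps)
  with assms(4) have "spherical_metric \<phi> x y =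
      norm y * (a * (x \<bullet> y / norm y) powr ((\<kappa> - 1) / \<kappa>) * (gram x y / (norm y)\<^sup>2) powr (1 / (2 * \<kappa>)))"
    by (simp add: spherical_metric_def)
  also have "\<dots> = exp (ln (norm y) + (ln a + ((\<kappa> - 1) / \<kappa>) * (ln (x \<bullet> y) - ln (norm y))
      + 1 / (2 * \<kappa>) * (ln (gram x y) - 2 * ln (norm y))))"
    using pos assms(2) by (simp add: exp_add powr_def ln_div ln_realpow)
  also have "ln (norm y) + (ln a + ((\<kappa> - 1) / \<kappa>) * (ln (x \<bullet> y) - ln (norm y))
      + 1 / (2 * \<kappa>) * (ln (gram x y) - 2 * ln (norm y)))
      = (2 * ln a + (2 - 2 * (1 / \<kappa>)) * ln (x \<bullet> y) + 1 / \<kappa> * ln (gram x y)) / 2"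
    using assms(3) by (simp add: field_simps)
  finally show ?thesis
    by (simp flip: exp_double)
qed

theorem theorem3p1:
  fixes I :: "real set" and a c :: "real \<Rightarrow> real" and \<phi> :: "real \<Rightarrow> real \<Rightarrow> real"
    and F :: "real^'n::finite \<Rightarrow> real^'n \<Rightarrow> real"
  assumes "CARD('n) \<ge> 3"
    and "open I" and "is_interval I" and "I \<subseteq> {0<..}"
    and "smooth_on I a" and "smooth_on I c"
    and "\<And>r. r \<in> I \<Longrightarrow> a r > 0"
    and "\<And>r. r \<in> I \<Longrightarrow> c r \<noteq> 0"
    and "\<And>r. r \<in> I \<Longrightarrow> c r * r\<^sup>2 \<noteq> 1"
    and "\<And>r s. r \<in> I \<Longrightarrow> 0 < s \<Longrightarrow> s < r \<Longrightarrow>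
      \<phi> r s = a r * s powr ((c r * r\<^sup>2 - 1) / (c r * r\<^sup>2))
                  * (r\<^sup>2 - s\<^sup>2) powr (1 / (2 * c r * r\<^sup>2))"
    and "\<And>x y. (x, y) \<in> conic_domain I \<Longrightarrow> F x y = spherical_metric \<phi> x y"
    and "T_condition (conic_domain I) F"
  shows "berwaldian (conic_domain I) F \<longleftrightarrow> (\<exists>C. C \<noteq> 1 \<and> (\<forall>r\<in>I. c r = C / r\<^sup>2))"
proof -
  define g where "g = (\<lambda>r. 1 / (c r * r\<^sup>2))"
  have diff: "(f has_real_derivative deriv f r) (at r)" if "smooth_on I f" "r \<in> I" for f r
  proof -
    have "f differentiable_on I"
      using that(1)[unfolded smooth_on_def, rule_format, of 0] by simp
    with that(2) assms(2) have "f differentiable at r"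
      using differentiable_on_eq_differentiable_at by blast
    then show ?thesis
      by (simp add: DERIV_deriv_iff_real_differentiable)
  qed
  have nz: "r \<noteq> 0" "c r * r\<^sup>2 \<noteq> 0" if "r \<in> I" for r
    using that assms(4,8) by auto
  have A: "((\<lambda>r. 2 * ln (a r)) has_real_derivative 2 * (deriv a r / a r)) (at r)" if "r \<in> I" for r
    using assms(7)[OF that] by (auto intro!: derivative_eq_intros diff[OF assms(5) that])
  have g: "(g has_real_derivative deriv g r) (at r)" if "r \<in> I" for r
  proof -
    have "c field_differentiable at r"
      using diff[OF assms(6) that] by (auto simp: field_differentiable_def)
    then have "g field_differentiable at r"
      unfolding g_def using nz[OF that] by (intro derivative_intros) auto
    then show ?thesis
      by (simp add: DERIV_deriv_iff_field_differentiable)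
  qed
  interpret spherical_power I "\<lambda>r. 2 * ln (a r)" "\<lambda>r. 2 * (deriv a r / a r)" g "deriv g" F
  proof
    show "g r \<noteq> 0" "g r \<noteq> 1" if "r \<in> I" for r
      using nz[OF that] assms(9)[OF that] by (auto simp: g_def)
    show "(F x y)\<^sup>2 = exp (2 * ln (a (norm x)) + (2 - 2 * g (norm x)) * ln (x \<bullet> y)
        + g (norm x) * ln (gram x y))" if dom: "(x, y) \<in> conic_domain I" for x y
    proof -
      have r: "norm x \<in> I" and "0 < x \<bullet> y / norm y" "x \<bullet> y / norm y < norm x"
        using dom by (auto simp: conic_domain_def)
      from assms(10)[OF this] show ?thesis
        unfolding assms(11)[OF dom] g_def
        by (intro spherical_metric_square[OF dom assms(7)[OF r] nz(2)[OF r]]) (simp add: mult_ac)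
    qed
  qed (use assms(2,4) A g in auto)
  have "(\<forall>r\<in>I. deriv g r = 0) \<longleftrightarrow> (\<exists>C. C \<noteq> 1 \<and> (\<forall>r\<in>I. c r = C / r\<^sup>2))"
  proof
    assume "\<forall>r\<in>I. deriv g r = 0"
    with g have "(g has_real_derivative 0) (at r within I)" if "r \<in> I" for r
      using that by (metis has_field_derivative_at_within)
    \<comment> \<open>A function with zero derivative on a convex set is constant; convexity comes
      from \<open>I\<close> being an interval.\<close>
    then obtain K where K: "g r = K" if "r \<in> I" for r
      using has_field_derivative_zero_constant[of I g] assms(3) is_interval_convex by blast
    have c: "c r = (1 / K) / r\<^sup>2" if "r \<in> I" for r
      unfolding K[OF that, symmetric] g_def using nz[OF that] by simp
    show "\<exists>C. C \<noteq> 1 \<and> (\<forall>r\<in>I. c r = C / r\<^sup>2)"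
    \<comment> \<open>For nonempty \<open>I\<close> the witness is \<open>1 / K\<close>, which
      differs from 1 because it equals \<open>c r * r\<^sup>2\<close> at some point. For empty
      \<open>I\<close> the value 0 serves.\<close>
    proof (cases "I = {}")
      case False
      then obtain r where r: "r \<in> I" by auto
      from c[OF r] nz[OF r] have "c r * r\<^sup>2 = 1 / K" by simp
      with assms(9)[OF r] c show ?thesis by metis
    qed (auto intro: exI[of _ 0])
  next
    assume "\<exists>C. C \<noteq> 1 \<and> (\<forall>r\<in>I. c r = C / r\<^sup>2)"
    then obtain C where C: "c r = C / r\<^sup>2" if "r \<in> I" for r by blast
    show "\<forall>r\<in>I. deriv g r = 0"
    proof
      fix r assume r: "r \<in> I"
      \<comment> \<open>\<open>deriv\<close> needs equality on a whole neighbourhood, which openness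
        of \<open>I\<close> provides.\<close>
      have "\<forall>\<^sub>F s in nhds r. g s = 1 / C"
        using eventually_nhds_in_open[OF assms(2) r]
        by eventually_elim (use C nz in \<open>auto simp: g_def\<close>)
      then have "deriv g r = deriv (\<lambda>_. 1 / C) r"
        by (intro deriv_cong_ev) auto
      then show "deriv g r = 0" by simp
    qed
  qed
  moreover have "berwaldian (conic_domain I) F \<longleftrightarrow> (\<forall>r\<in>I. deriv g r = 0)"
    using berwaldian_imp_deriv_zero deriv_zero_imp_berwaldian assms(1) by auto
  ultimately show ?thesis by simp
qed

end
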